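(* For every integer $r>0$, the group $$G_2=\langle x,y \,\|\, xy^{-1}x^{-1}yx=y^{-2}xyx^{-1}y^{-1}xy^{2}\rangle$$ is not isomorphic to the group $$G_{1,r}=\langle x,y \,\|\, x^{-r}y^{-1}xyx^{r}=y^{-2}x^{r}yxy^{-1}x^{-r}y^{2}\rangle.$$
   Context: $\langle X\,\|\,R\rangle$ denotes the group with generators $X$ and defining relations $R$. (These are groups of the virtual trefoil.) *)

theory Defs
  imports "HOL-Algebra.Coset"
begin

section \<open>Free groups\<close>

text \<open>The letter \<open>(a, True)\<close> stands for the generator \<open>a\<close>, the letter \<open>(a, False)\<close> for its
  formal inverse.\<close>

type_synonym 'a word = "('a \<times> bool) list"

definition words :: "'a set \<Rightarrow> 'a word set"
  where "words X = lists (X \<times> UNIV)"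

inductive free_eq :: "'a set \<Rightarrow> 'a word \<Rightarrow> 'a word \<Rightarrow> bool" for X :: "'a set" where
  refl: "w \<in> words X \<Longrightarrow> free_eq X w w"
| sym: "free_eq X v w \<Longrightarrow> free_eq X w v"
| trans: "free_eq X u v \<Longrightarrow> free_eq X v w \<Longrightarrow> free_eq X u w"
| cancel: "u \<in> words X \<Longrightarrow> v \<in> words X \<Longrightarrow> a \<in> X \<Longrightarrow>
    free_eq X (u @ [(a, b), (a, \<not> b)] @ v) (u @ v)"

definition free_class :: "'a set \<Rightarrow> 'a word \<Rightarrow> 'a word set"
  where "free_class X w = {v. free_eq X w v}"

definition free_group :: "'a set \<Rightarrow> 'a word set monoid"
  where "free_group X = \<lparr>
    carrier = free_class X ` words X,
    mult = (\<lambda>A B. \<Union>u\<in>A. \<Union>v\<in>B. free_class X (u @ v)),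
    one = free_class X []\<rparr>"

definition free_gen :: "'a set \<Rightarrow> 'a \<Rightarrow> 'a word set"
  where "free_gen X a = free_class X [(a, True)]"

section \<open>Group presentations\<close>

definition normal_closure :: "('a, 'b) monoid_scheme \<Rightarrow> 'a set \<Rightarrow> 'a set"
  where "normal_closure G S = \<Inter> {N. N \<lhd> G \<and> S \<subseteq> N}"

text \<open>The group with generators \<open>X\<close> and defining relations \<open>R\<close>; a pair \<open>(u, v)\<close> of elements of
  the free group on \<open>X\<close> stands for the relation \<open>u = v\<close>.\<close>

definition presented_group ::
    "'a set \<Rightarrow> ('a word set \<times> 'a word set) set \<Rightarrow> 'a word set set monoid"
  where "presented_group X R =
    free_group X Mod
      normal_closure (free_group X)
        {u \<otimes>\<^bsub>free_group X\<^esub> inv\<^bsub>free_group X\<^esub> v | u v. (u, v) \<in> R}"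

section \<open>The groups \<open>G\<^sub>2\<close> and \<open>G\<^sub>1\<^sub>,\<^sub>r\<close>\<close>

datatype gen = GenX | GenY

definition G2_relation :: "('a, 'b) monoid_scheme \<Rightarrow> 'a \<Rightarrow> 'a \<Rightarrow> 'a \<times> 'a"
  where "G2_relation F x y =
    (x \<otimes> inv y \<otimes> inv x \<otimes> y \<otimes> x,
     y [^] (-2::int) \<otimes> x \<otimes> y \<otimes> inv x \<otimes> inv y \<otimes> x \<otimes> y [^] (2::int))"
  for F (structure)

definition G1_relation :: "('a, 'b) monoid_scheme \<Rightarrow> int \<Rightarrow> 'a \<Rightarrow> 'a \<Rightarrow> 'a \<times> 'a"
  where "G1_relation F r x y =
    (x [^] (-r) \<otimes> inv y \<otimes> x \<otimes> y \<otimes> x [^] r,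
     y [^] (-2::int) \<otimes> x [^] r \<otimes> y \<otimes> x \<otimes> inv y \<otimes> x [^] (-r) \<otimes> y [^] (2::int))"
  for F (structure)

definition G2 :: "gen word set set monoid"
  where "G2 = presented_group {GenX, GenY}
    {G2_relation (free_group {GenX, GenY})
       (free_gen {GenX, GenY} GenX) (free_gen {GenX, GenY} GenY)}"

definition G1 :: "int \<Rightarrow> gen word set set monoid"
  where "G1 r = presented_group {GenX, GenY}
    {G1_relation (free_group {GenX, GenY}) r
       (free_gen {GenX, GenY} GenX) (free_gen {GenX, GenY} GenY)}"

section \<open>These are groups\<close>

lemma free_eq_words: "free_eq X u v \<Longrightarrow> u \<in> words X \<and> v \<in> words X"
  by (induction rule: free_eq.induct) (auto simp: words_def)

lemma free_eq_append_left:
  "free_eq X u v \<Longrightarrow> w \<in> words X \<Longrightarrow> free_eq X (w @ u) (w @ v)"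
proof (induction rule: free_eq.induct)
  case (refl u)
  then show ?case by (auto intro: free_eq.refl simp: words_def)
next
  case (cancel u v a b)
  then have "w @ u \<in> words X" by (auto simp: words_def)
  from free_eq.cancel[OF this cancel(2,3), of b] show ?case by simp
qed (use free_eq.sym free_eq.trans in metis)+

lemma free_eq_append_right:
  "free_eq X u v \<Longrightarrow> w \<in> words X \<Longrightarrow> free_eq X (u @ w) (v @ w)"
proof (induction rule: free_eq.induct)
  case (refl u)
  then show ?case by (auto intro: free_eq.refl simp: words_def)
next
  case (cancel u v a b)
  then have "v @ w \<in> words X" by (auto simp: words_def)
  from free_eq.cancel[OF cancel(1) this cancel(3), of b] show ?case by simp
qed (use free_eq.sym free_eq.trans in metis)+

lemma free_eq_append:
  "free_eq X u u' \<Longrightarrow> free_eq X v v' \<Longrightarrow> free_eq X (u @ v) (u' @ v')"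
  by (meson free_eq.trans free_eq_append_left free_eq_append_right free_eq_words)

lemma free_class_eq: "free_eq X u v \<Longrightarrow> free_class X u = free_class X v"
  unfolding free_class_def using free_eq.sym free_eq.trans by blast

lemma free_class_self: "u \<in> words X \<Longrightarrow> u \<in> free_class X u"
  by (simp add: free_class_def free_eq.refl)

lemma free_group_mult:
  assumes "u \<in> words X" "v \<in> words X"
  shows "free_class X u \<otimes>\<^bsub>free_group X\<^esub> free_class X v = free_class X (u @ v)"
proof -
  have *: "free_class X (u' @ v') = free_class X (u @ v)"
    if "u' \<in> free_class X u" "v' \<in> free_class X v" for u' v'
    using that free_class_eq[OF free_eq_append, of X u u' v v'] by (simp add: free_class_def)
  have "(\<Union>u'\<in>free_class X u. \<Union>v'\<in>free_class X v. free_class X (u' @ v')) =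
      (\<Union>u'\<in>free_class X u. \<Union>v'\<in>free_class X v. free_class X (u @ v))"
    by (intro SUP_cong HOL.refl *)
  also have "\<dots> = free_class X (u @ v)"
    using free_class_self[OF assms(1)] free_class_self[OF assms(2)]
    by (metis UN_constant empty_iff)
  finally show ?thesis by (simp add: free_group_def)
qed

lemma words_append: "u \<in> words X \<Longrightarrow> v \<in> words X \<Longrightarrow> u @ v \<in> words X"
  by (auto simp: words_def)

lemma free_eq_inverse:
  "w \<in> words X \<Longrightarrow> free_eq X (rev (map (\<lambda>(a, b). (a, \<not> b)) w) @ w) []"
proof (induction w)
  case Nil
  then show ?case by (auto intro: free_eq.refl)
next
  case (Cons p w)
  obtain a b where p: "p = (a, b)" by fastforce
  from Cons p have a: "a \<in> X" "w \<in> words X" by (auto simp: words_def)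
  then have "rev (map (\<lambda>(a, b). (a, \<not> b)) w) \<in> words X" by (auto simp: words_def)
  from free_eq.cancel[OF this a(2) a(1), of "\<not> b"] Cons.IH[OF a(2)]
  show ?case by (auto simp: p intro: free_eq.trans)
qed

lemma group_free_group: "group (free_group X)"
proof (rule groupI)
  show "\<one>\<^bsub>free_group X\<^esub> \<in> carrier (free_group X)"
    by (auto simp: free_group_def words_def)
next
  fix A assume "A \<in> carrier (free_group X)"
  then obtain w where w: "w \<in> words X" "A = free_class X w" by (auto simp: free_group_def)
  let ?w = "rev (map (\<lambda>(a, b). (a, \<not> b)) w)"
  have w': "?w \<in> words X" using w(1) by (auto simp: words_def)
  have "free_class X ?w \<otimes>\<^bsub>free_group X\<^esub> A = \<one>\<^bsub>free_group X\<^esub>"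
    using free_class_eq[OF free_eq_inverse[OF w(1)]] free_group_mult[OF w' w(1)] w(2)
    by (simp add: free_group_def)
  moreover have "free_class X ?w \<in> carrier (free_group X)" using w' by (simp add: free_group_def)
  ultimately show "\<exists>B\<in>carrier (free_group X). B \<otimes>\<^bsub>free_group X\<^esub> A = \<one>\<^bsub>free_group X\<^esub>" by blast
  have nil: "[] \<in> words X" by (simp add: words_def)
  show "\<one>\<^bsub>free_group X\<^esub> \<otimes>\<^bsub>free_group X\<^esub> A = A"
    using free_group_mult[OF nil w(1)] w(2) by (simp add: free_group_def)
next
  fix A B assume "A \<in> carrier (free_group X)" "B \<in> carrier (free_group X)"
  then obtain u v where uv: "u \<in> words X" "v \<in> words X" "A = free_class X u" "B = free_class X v"
    by (auto simp: free_group_def)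
  show "A \<otimes>\<^bsub>free_group X\<^esub> B \<in> carrier (free_group X)"
    unfolding uv(3,4) free_group_mult[OF uv(1,2)]
    using words_append[OF uv(1,2)] by (simp add: free_group_def)
  fix C assume "C \<in> carrier (free_group X)"
  then obtain w where w: "w \<in> words X" "C = free_class X w" by (auto simp: free_group_def)
  show "A \<otimes>\<^bsub>free_group X\<^esub> B \<otimes>\<^bsub>free_group X\<^esub> C = A \<otimes>\<^bsub>free_group X\<^esub> (B \<otimes>\<^bsub>free_group X\<^esub> C)"
    using uv w by (simp add: free_group_mult words_append)
qed

lemma (in group) normal_closure_normal:
  assumes "S \<subseteq> carrier G"
  shows "normal_closure G S \<lhd> G"
proof -
  have car: "carrier G \<in> {N. N \<lhd> G \<and> S \<subseteq> N}"
    using assms by (auto simp: normal_inv_iff subgroup_self)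
  have "subgroup (normal_closure G S) G"
    unfolding normal_closure_def
    by (rule subgroups_Inter) (use car in \<open>auto simp: normal_inv_iff\<close>)
  then show ?thesis
    by (auto simp: normal_inv_iff normal_closure_def)
qed

lemma group_presented_group:
  assumes "R \<subseteq> carrier (free_group X) \<times> carrier (free_group X)"
  shows "group (presented_group X R)"
proof -
  interpret group "free_group X" by (rule group_free_group)
  show ?thesis
    unfolding presented_group_def
    by (rule normal.factorgroup_is_group, rule normal_closure_normal) (use assms in auto)
qed

lemma free_gen_carrier: "a \<in> X \<Longrightarrow> free_gen X a \<in> carrier (free_group X)"
  by (auto simp: free_gen_def free_group_def words_def)

lemma group_G2: "group G2"
proof -
  interpret group "free_group {GenX, GenY}" by (rule group_free_group)
  show ?thesis
    unfolding G2_def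
    by (rule group_presented_group) (simp add: G2_relation_def free_gen_carrier)
qed

lemma group_G1: "group (G1 r)"
proof -
  interpret group "free_group {GenX, GenY}" by (rule group_free_group)
  show ?thesis
    unfolding G1_def
    by (rule group_presented_group) (simp add: G1_relation_def free_gen_carrier)
qed

end

(* The Alexander polynomial of G2 is 2(t + 1), which vanishes modulo 2, so every pair of elements of
   a group with an elementary abelian normal 2-subgroup and abelian quotient satisfies the relation
   of G2. That of G1 r is (s^r - 1)(t - s^r), so in the wreath product Q of Z/2 by Z/m, with
   m = 2r + 2, some pair violates the relation of G1 r. As Q is finite, precomposition with an
   isomorphism would give an injection, hence a bijection, from Q x Q = Hom(G2, Q) to
   Hom(G1 r, Q), a proper subset of Q x Q. *)

theory Submission
  imports Defs
begin

section \<open>Homomorphisms out of presented groups\<close>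

text \<open>Evaluation is defined on words rather than on classes, so that its invariance can be
  proved by induction on \<open>free_eq\<close>.\<close>

definition word_eval :: "('b, 'c) monoid_scheme \<Rightarrow> ('a \<Rightarrow> 'b) \<Rightarrow> 'a word \<Rightarrow> 'b"
  where "word_eval G a w =
    foldr (\<lambda>(c, b) z. (if b then a c else inv\<^bsub>G\<^esub> a c) \<otimes>\<^bsub>G\<^esub> z) w \<one>\<^bsub>G\<^esub>"

lemma word_eval_Nil [simp]: "word_eval G a [] = \<one>\<^bsub>G\<^esub>"
  by (simp add: word_eval_def)

lemma word_eval_Cons [simp]:
  "word_eval G a ((c, b) # w) = (if b then a c else inv\<^bsub>G\<^esub> a c) \<otimes>\<^bsub>G\<^esub> word_eval G a w"
  by (simp add: word_eval_def)

lemma Nil_in_words [simp]: "[] \<in> words X"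
  by (simp add: words_def)

lemma Cons_in_words [simp]: "(c, b) # w \<in> words X \<longleftrightarrow> c \<in> X \<and> w \<in> words X"
  by (auto simp: words_def)

context group
begin

lemma word_eval_closed:
  assumes "a \<in> X \<rightarrow> carrier G" "w \<in> words X"
  shows "word_eval G a w \<in> carrier G"
  using assms(2) by (induction w) (use assms(1) in \<open>auto simp: Pi_iff\<close>)

lemma word_eval_append:
  assumes a: "a \<in> X \<rightarrow> carrier G" and u: "u \<in> words X" and v: "v \<in> words X"
  shows "word_eval G a (u @ v) = word_eval G a u \<otimes> word_eval G a v"
  using u
proof (induction u)
  case Nil
  then show ?case using word_eval_closed[OF a v] by simp
next
  case (Cons p u)
  obtain c b where p: "p = (c, b)" by fastforce
  have "a c \<in> carrier G" "u \<in> words X" using Cons.prems a by (auto simp: p)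
  then show ?case
    using Cons.IH word_eval_closed[OF a] v by (simp add: p m_assoc)
qed

lemma word_eval_free_eq:
  assumes a: "a \<in> X \<rightarrow> carrier G" and "free_eq X u v"
  shows "word_eval G a u = word_eval G a v"
  using assms(2)
proof (induction rule: free_eq.induct)
  case (cancel u v c b)
  have c: "a c \<in> carrier G" using cancel(3) a by blast
  have "word_eval G a ([(c, b), (c, \<not> b)] @ v) = word_eval G a v"
    using c word_eval_closed[OF a cancel(2)] by (cases b) (simp_all flip: m_assoc)
  moreover have "[(c, b), (c, \<not> b)] @ v \<in> words X"
    using cancel by simp
  ultimately show ?case
    using cancel(1,2) by (simp only: word_eval_append[OF a])
qed auto

text \<open>Existence half of the universal property: evaluation of words is constant on
  \<open>free_eq\<close>-classes and therefore descends to them.\<close>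

lemma free_group_extend:
  assumes a: "a \<in> X \<rightarrow> carrier G"
  obtains h where "h \<in> hom (free_group X) G" "\<And>c. c \<in> X \<Longrightarrow> h (free_gen X c) = a c"
proof -
  have "\<exists>h. \<forall>w. w \<in> words X \<longrightarrow> word_eval G a w = h (free_class X w)"
  proof (subst function_factors_left_gen[symmetric], intro allI impI)
    fix u v assume uv: "u \<in> words X \<and> v \<in> words X \<and> free_class X u = free_class X v"
    \<comment> \<open>\<open>v\<close> belongs to its own class, hence to the class of
      \<open>u\<close>.\<close>
    then have "free_eq X u v"
      using free_class_self[of v X] by (auto simp: free_class_def)
    then show "word_eval G a u = word_eval G a v"
      by (rule word_eval_free_eq[OF a])
  qed
  then obtain h where h: "\<And>w. w \<in> words X \<Longrightarrow> h (free_class X w) = word_eval G a w"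
    by metis
  show thesis
  proof
    show "h \<in> hom (free_group X) G"
    proof (rule homI)
      fix A B assume "A \<in> carrier (free_group X)" "B \<in> carrier (free_group X)"
      then obtain u v where uv: "u \<in> words X" "v \<in> words X" "A = free_class X u" "B = free_class X v"
        by (auto simp: free_group_def)
      show "h A \<in> carrier G"
        using uv word_eval_closed[OF a] by (simp add: h)
      show "h (A \<otimes>\<^bsub>free_group X\<^esub> B) = h A \<otimes> h B"
        using uv by (simp add: h free_group_mult words_append word_eval_append[OF a])
    qed
    show "h (free_gen X c) = a c" if "c \<in> X" for c
    proof -
      have "a c \<in> carrier G" using that a by blast
      then show ?thesis using that by (simp add: free_gen_def h)
    qed
  qed
qed

end

text \<open>Uniqueness half: every class is a product of letters, and a negative letter is the
  inverse of a generator.\<close>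

lemma hom_free_group_eqI:
  assumes G: "group G" and f: "f \<in> hom (free_group X) G" and g: "g \<in> hom (free_group X) G"
    and gen: "\<And>c. c \<in> X \<Longrightarrow> f (free_gen X c) = g (free_gen X c)"
    and A: "A \<in> carrier (free_group X)"
  shows "f A = g A"
proof -
  interpret F: group "free_group X" by (rule group_free_group)
  interpret f: group_hom "free_group X" G f
    using G f by (simp add: group_hom_def group_hom_axioms_def F.is_group)
  interpret g: group_hom "free_group X" G g
    using G g by (simp add: group_hom_def group_hom_axioms_def F.is_group)
  have inv_gen: "inv\<^bsub>free_group X\<^esub> free_gen X c = free_class X [(c, False)]" if "c \<in> X" for c
  proof (rule F.inv_equality)
    show "free_class X [(c, False)] \<otimes>\<^bsub>free_group X\<^esub> free_gen X c = \<one>\<^bsub>free_group X\<^esub>"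
      using that free_class_eq[OF free_eq.cancel[of "[]" X "[]" c False]]
      by (simp add: free_gen_def free_group_mult) (simp add: free_group_def)
  qed (use that in \<open>auto simp: free_gen_carrier\<close>, auto simp: free_group_def)
  have "f (free_class X w) = g (free_class X w)" if "w \<in> words X" for w
    using that
  proof (induction w)
    case Nil
    have "free_class X [] = \<one>\<^bsub>free_group X\<^esub>" by (simp add: free_group_def)
    then show ?case by simp
  next
    case (Cons p w)
    obtain c b where p: "p = (c, b)" by fastforce
    have cw: "c \<in> X" "w \<in> words X" using Cons.prems by (auto simp: p)
    have letter: "f (free_class X [(c, b)]) = g (free_class X [(c, b)])"
    proof (cases b)
      case True
      then show ?thesis using gen[OF cw(1)] by (simp add: free_gen_def)
    next
      case False
      then show ?thesis
        using gen[OF cw(1)] cw(1) by (simp add: free_gen_carrier flip: inv_gen)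
    qed
    have eq: "free_class X (p # w) = free_class X [(c, b)] \<otimes>\<^bsub>free_group X\<^esub> free_class X w"
      using cw by (simp add: p free_group_mult)
    have "free_class X [(c, b)] \<in> carrier (free_group X)" "free_class X w \<in> carrier (free_group X)"
      using cw by (auto simp: free_group_def)
    then show ?case
      using letter Cons.IH[OF cw(2)] by (simp add: eq)
  qed
  then show ?thesis using A by (auto simp: free_group_def)
qed

section \<open>Universal property of presented groups\<close>

text \<open>This is the canonical projection of the free group onto its quotient.\<close>

definition presentation_proj ::
    "'a set \<Rightarrow> ('a word set \<times> 'a word set) set \<Rightarrow> 'a word set \<Rightarrow> 'a word set set"
  where "presentation_proj X R A =
    normal_closure (free_group X)
      {u \<otimes>\<^bsub>free_group X\<^esub> inv\<^bsub>free_group X\<^esub> v | u v. (u, v) \<in> R} #>\<^bsub>free_group X\<^esub> A"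

context
  fixes X :: "'a set" and R :: "('a word set \<times> 'a word set) set"
  assumes R: "R \<subseteq> carrier (free_group X) \<times> carrier (free_group X)"
begin

interpretation F: group "free_group X" by (rule group_free_group)

lemma relators_normal:
  "normal_closure (free_group X)
     {u \<otimes>\<^bsub>free_group X\<^esub> inv\<^bsub>free_group X\<^esub> v | u v. (u, v) \<in> R} \<lhd> free_group X"
  by (rule F.normal_closure_normal) (use R in auto)

lemma presentation_proj_hom:
  "presentation_proj X R \<in> hom (free_group X) (presented_group X R)"
proof -
  have "presentation_proj X R = (#>\<^bsub>free_group X\<^esub>) (normal_closure (free_group X)
      {u \<otimes>\<^bsub>free_group X\<^esub> inv\<^bsub>free_group X\<^esub> v | u v. (u, v) \<in> R})"
    by (rule ext) (simp add: presentation_proj_def)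
  then show ?thesis
    using normal.r_coset_hom_Mod[OF relators_normal] by (simp add: presented_group_def)
qed

lemma presentation_proj_surj:
  "carrier (presented_group X R) = presentation_proj X R ` carrier (free_group X)"
  by (simp add: presented_group_def carrier_FactGroup presentation_proj_def)

lemma presentation_proj_relation:
  assumes uv: "(u, v) \<in> R"
  shows "presentation_proj X R u = presentation_proj X R v"
proof -
  let ?N = "normal_closure (free_group X)
      {u \<otimes>\<^bsub>free_group X\<^esub> inv\<^bsub>free_group X\<^esub> v | u v. (u, v) \<in> R}"
  interpret normal ?N "free_group X" by (rule relators_normal)
  have c: "u \<in> carrier (free_group X)" "v \<in> carrier (free_group X)" using uv R by auto
  have "u \<otimes>\<^bsub>free_group X\<^esub> inv\<^bsub>free_group X\<^esub> v \<in> ?N"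
    using uv by (auto simp: normal_closure_def)
  then have "u \<in> ?N #>\<^bsub>free_group X\<^esub> v"
    using c by (intro rcos_module_rev[OF F.is_group])
  then have "?N #>\<^bsub>free_group X\<^esub> v = ?N #>\<^bsub>free_group X\<^esub> u"
    by (rule F.repr_independence[OF _ c(2) is_subgroup])
  then show ?thesis
    by (simp only: presentation_proj_def)
qed

text \<open>The kernel of \<open>f\<close> is normal and contains all relators, hence their normal
  closure, so \<open>f\<close> factors through the quotient.\<close>

lemma presented_group_extend:
  assumes G: "group G" and f: "f \<in> hom (free_group X) G"
    and rel: "\<And>u v. (u, v) \<in> R \<Longrightarrow> f u = f v"
  obtains h where "h \<in> hom (presented_group X R) G"
    "\<And>A. A \<in> carrier (free_group X) \<Longrightarrow> h (presentation_proj X R A) = f A"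
proof -
  interpret f: group_hom "free_group X" G f
    using G f by (simp add: group_hom_def group_hom_axioms_def F.is_group)
  have "{u \<otimes>\<^bsub>free_group X\<^esub> inv\<^bsub>free_group X\<^esub> v | u v. (u, v) \<in> R} \<subseteq> kernel (free_group X) G f"
    using R rel by (fastforce simp: kernel_def)
  then have "normal_closure (free_group X)
      {u \<otimes>\<^bsub>free_group X\<^esub> inv\<^bsub>free_group X\<^esub> v | u v. (u, v) \<in> R} \<subseteq> kernel (free_group X) G f"
    using f.normal_kernel by (auto simp: normal_closure_def)
  from f.FactGroup_universal_kernel[OF relators_normal this] obtain h
    where h: "h \<in> hom (presented_group X R) G"
      "\<And>A. A \<in> carrier (free_group X) \<Longrightarrow> h (presentation_proj X R A) = f A"
    unfolding presented_group_def presentation_proj_def by blast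
  then show thesis by (rule that)
qed

text \<open>The projection is onto, so the claim reduces to uniqueness on the free group.\<close>

lemma hom_presented_group_eqI:
  assumes "group G" "f \<in> hom (presented_group X R) G" "g \<in> hom (presented_group X R) G"
    and "\<And>c. c \<in> X \<Longrightarrow>
      f (presentation_proj X R (free_gen X c)) = g (presentation_proj X R (free_gen X c))"
    and "a \<in> carrier (presented_group X R)"
  shows "f a = g a"
proof -
  obtain A where A: "A \<in> carrier (free_group X)" "a = presentation_proj X R A"
    using assms(5) presentation_proj_surj by auto
  have "(f \<circ> presentation_proj X R) A = (g \<circ> presentation_proj X R) A"
  proof (rule hom_free_group_eqI[OF assms(1) _ _ _ A(1)])
    show "f \<circ> presentation_proj X R \<in> hom (free_group X) G"
      by (rule Group.hom_compose[OF presentation_proj_hom assms(2)])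
    show "g \<circ> presentation_proj X R \<in> hom (free_group X) G"
      by (rule Group.hom_compose[OF presentation_proj_hom assms(3)])
  qed (use assms(4) in simp)
  then show ?thesis by (simp add: A)
qed

end

section \<open>The wreath product of the group of order two with a cyclic group\<close>

text \<open>A function on the cyclic group of order \<open>m\<close> is encoded as an \<open>m\<close>-periodic function on the
  integers.\<close>

definition lamplighter :: "int \<Rightarrow> ((int \<Rightarrow> bool) \<times> int) monoid"
  where "lamplighter m = \<lparr>
    carrier = {f. \<forall>k. f (k mod m) = f k} \<times> {0..<m},
    mult = (\<lambda>(f, i) (g, j). (\<lambda>k. f k \<noteq> g (k - i), (i + j) mod m)),
    one = (\<lambda>_. False, 0)\<rparr>"

lemma lamplighter_mult [simp]:
  "(f, i) \<otimes>\<^bsub>lamplighter m\<^esub> (g, j) = (\<lambda>k. f k \<noteq> g (k - i), (i + j) mod m)"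
  by (simp add: lamplighter_def)

lemma lamplighter_one: "\<one>\<^bsub>lamplighter m\<^esub> = (\<lambda>_. False, 0)"
  by (simp add: lamplighter_def)

lemma in_carrier_lamplighter:
  "(f, i) \<in> carrier (lamplighter m) \<longleftrightarrow> (\<forall>k. f (k mod m) = f k) \<and> 0 \<le> i \<and> i < m"
  by (simp add: lamplighter_def)

text \<open>Writing the function as \<open>F (k mod m)\<close> puts periodicity into the shape of
  the term, so later identities become arithmetic of residues.\<close>

lemma lamplighter_carrierE:
  assumes "x \<in> carrier (lamplighter m)"
  obtains F i where "x = (\<lambda>k. F (k mod m), i)" "0 \<le> i" "i < m"
proof -
  obtain f i where x: "x = (f, i)" by fastforce
  have "f = (\<lambda>k. f (k mod m))" "0 \<le> i" "i < m"
    using assms by (auto simp: x in_carrier_lamplighter)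
  then show thesis using that x by metis
qed

text \<open>A periodic function is determined by the subset of \<open>{0..<m}\<close> on which it
  holds.\<close>

lemma finite_lamplighter: "finite (carrier (lamplighter m))"
proof (cases "m > 0")
  case True
  let ?P = "{f :: int \<Rightarrow> bool. \<forall>k. f (k mod m) = f k}"
  have "inj_on (\<lambda>f. {k \<in> {0..<m}. f k}) ?P"
  proof (rule inj_onI, rule ext)
    fix f g :: "int \<Rightarrow> bool" and k
    assume f: "f \<in> ?P" and g: "g \<in> ?P" and eq: "{k \<in> {0..<m}. f k} = {k \<in> {0..<m}. g k}"
    have "k mod m \<in> {k \<in> {0..<m}. f k} \<longleftrightarrow> k mod m \<in> {k \<in> {0..<m}. g k}"
      by (simp only: eq)
    then have "f (k mod m) = g (k mod m)" using True by simp
    moreover have "f (k mod m) = f k" "g (k mod m) = g k" using f g by blast+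
    ultimately show "f k = g k" by simp
  qed
  moreover have "(\<lambda>f. {k \<in> {0..<m}. f k}) ` ?P \<subseteq> Pow {0..<m}" by blast
  ultimately have "finite ?P" by (rule inj_on_finite) simp
  then have "finite (?P \<times> {0..<m})" by (rule finite_cartesian_product) simp
  then show ?thesis by (simp only: lamplighter_def partial_object.simps)
next
  \<comment> \<open>Here \<open>{0..<m}\<close> is empty, and so is the carrier.\<close>
  case False
  then show ?thesis by (simp add: lamplighter_def)
qed

lemma group_lamplighter:
  assumes m: "m > 0"
  shows "group (lamplighter m)"
proof (rule groupI)
  show "\<one>\<^bsub>lamplighter m\<^esub> \<in> carrier (lamplighter m)"
    using m by (simp add: in_carrier_lamplighter lamplighter_one)
next
  fix x y assume "x \<in> carrier (lamplighter m)" "y \<in> carrier (lamplighter m)"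
  then obtain F i G j where xy: "x = (\<lambda>k. F (k mod m), i)" "y = (\<lambda>k. G (k mod m), j)"
      "0 \<le> i" "i < m" "0 \<le> j" "j < m"
    by (elim lamplighter_carrierE) blast
  then show "x \<otimes>\<^bsub>lamplighter m\<^esub> y \<in> carrier (lamplighter m)"
    using m by (simp add: in_carrier_lamplighter mod_simps)
  fix z assume "z \<in> carrier (lamplighter m)"
  then obtain H l where z: "z = (\<lambda>k. H (k mod m), l)" by (elim lamplighter_carrierE) blast
  show "x \<otimes>\<^bsub>lamplighter m\<^esub> y \<otimes>\<^bsub>lamplighter m\<^esub> z = x \<otimes>\<^bsub>lamplighter m\<^esub> (y \<otimes>\<^bsub>lamplighter m\<^esub> z)"
    by (simp add: xy z mod_simps diff_diff_eq add.assoc) blast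
next
  fix x assume "x \<in> carrier (lamplighter m)"
  then obtain F i where x: "x = (\<lambda>k. F (k mod m), i)" "0 \<le> i" "i < m"
    by (elim lamplighter_carrierE) blast
  show "\<one>\<^bsub>lamplighter m\<^esub> \<otimes>\<^bsub>lamplighter m\<^esub> x = x"
    using x by (simp add: lamplighter_one)
  have "(\<lambda>k. F ((k + i) mod m), (- i) mod m) \<in> carrier (lamplighter m)"
    using m by (simp add: in_carrier_lamplighter mod_simps)
  moreover have "(\<lambda>k. F ((k + i) mod m), (- i) mod m) \<otimes>\<^bsub>lamplighter m\<^esub> x = \<one>\<^bsub>lamplighter m\<^esub>"
    by (simp add: x lamplighter_one mod_simps)
  ultimately show "\<exists>y\<in>carrier (lamplighter m). y \<otimes>\<^bsub>lamplighter m\<^esub> x = \<one>\<^bsub>lamplighter m\<^esub>"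
    by blast
qed

text \<open>Functions modulo 2 are their own negatives, so inversion only shifts them back.\<close>

lemma lamplighter_inv:
  assumes m: "m > 0" and i: "0 \<le> i" "i < m"
  shows "inv\<^bsub>lamplighter m\<^esub> (\<lambda>k. F (k mod m), i) = (\<lambda>k. F ((k + i) mod m), (- i) mod m)"
proof (rule group.inv_equality[OF group_lamplighter[OF m]])
  show "(\<lambda>k. F ((k + i) mod m), (- i) mod m) \<otimes>\<^bsub>lamplighter m\<^esub> (\<lambda>k. F (k mod m), i) =
      \<one>\<^bsub>lamplighter m\<^esub>"
    by (simp add: lamplighter_one mod_simps)
qed (use m i in \<open>auto simp: in_carrier_lamplighter mod_simps\<close>)

section \<open>The two relations in the wreath product\<close>

text \<open>Let \<open>s\<close> and \<open>t\<close> denote translation by the second components of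
  \<open>x\<close> and \<open>y\<close>. With integer coefficients, the first components of the two
  sides would differ by 2(1 - t^-2) applied to that of \<open>x\<close> plus 2(t^-1 + t^-2)(1 - s)
  applied to that of \<open>y\<close>. Modulo 2 this vanishes, and the second components agree
  because the quotient is abelian.\<close>

lemma lamplighter_G2_relation:
  assumes m: "m > 0" and x: "x \<in> carrier (lamplighter m)" and y: "y \<in> carrier (lamplighter m)"
  shows "fst (G2_relation (lamplighter m) x y) = snd (G2_relation (lamplighter m) x y)"
proof -
  interpret group "lamplighter m" by (rule group_lamplighter[OF m])
  obtain F i G j where xy: "x = (\<lambda>k. F (k mod m), i)" "y = (\<lambda>k. G (k mod m), j)"
      and ij: "0 \<le> i" "i < m" "0 \<le> j" "j < m"
    using x y by (elim lamplighter_carrierE) blast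
  have pow2: "y [^]\<^bsub>lamplighter m\<^esub> (2::int) = y \<otimes>\<^bsub>lamplighter m\<^esub> y"
    using y by (simp add: int_pow_def2 numeral_2_eq_2)
  have pow2': "y [^]\<^bsub>lamplighter m\<^esub> (-2::int) = inv\<^bsub>lamplighter m\<^esub> y \<otimes>\<^bsub>lamplighter m\<^esub> inv\<^bsub>lamplighter m\<^esub> y"
    using y by (simp add: int_pow_neg pow2 inv_mult_group)
  \<comment> \<open>Kept opaque: the default simplification of \<open>\<noteq>\<close> on truth values would defeat rewriting
    modulo associativity and commutativity.\<close>
  define xor :: "bool \<Rightarrow> bool \<Rightarrow> bool" where "xor a b \<longleftrightarrow> a \<noteq> b" for a b
  have mult: "(f, i) \<otimes>\<^bsub>lamplighter m\<^esub> (g, j) = (\<lambda>k. xor (f k) (g (k - i)), (i + j) mod m)"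
    for f g i j by (simp add: xor_def)
  have xor: "xor (xor a b) c = xor a (xor b c)" "xor a b = xor b a"
    "xor a (xor b c) = xor b (xor a c)" "xor a (xor a b) = b"
    "xor a a = False" "xor a False = a" "xor False a = a" for a b c
    by (auto simp: xor_def)
  have mod_diff_add: "(k - (a + b mod m)) mod m = (k - (a + b)) mod m" for k a b :: int
    by (metis mod_add_right_eq mod_diff_right_eq)
  show ?thesis
    unfolding G2_relation_def fst_conv snd_conv pow2 pow2'
    unfolding xy lamplighter_inv[OF m ij(1,2)] lamplighter_inv[OF m ij(3,4)]
    \<comment> \<open>The words are multiplied out first; then the translations are normalised and
      equal terms cancel in pairs.\<close>
    by (simp add: mult mod_simps del: lamplighter_mult)
      (simp add: mod_simps mod_diff_add algebra_simps xor)
qed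

lemma lamplighter_pow_shift:
  assumes m: "m > 1"
  shows "(\<lambda>_. False, 1) [^]\<^bsub>lamplighter m\<^esub> (n::int) = (\<lambda>_. False, n mod m)"
proof -
  interpret group "lamplighter m" by (rule group_lamplighter) (use m in simp)
  have nat: "(\<lambda>_. False, 1) [^]\<^bsub>lamplighter m\<^esub> (n::nat) = (\<lambda>_. False, int n mod m)" for n
    by (induction n) (simp_all add: lamplighter_one mod_simps algebra_simps)
  have "inv\<^bsub>lamplighter m\<^esub> (\<lambda>_. False, k mod m) = (\<lambda>_. False, (- k) mod m)" for k
    using lamplighter_inv[of m "k mod m" "\<lambda>_. False"] m by (simp add: mod_simps)
  then show ?thesis
    by (simp add: int_pow_def2 nat)
qed

text \<open>Take \<open>x\<close> to be the unit shift and \<open>y\<close> a single lamp at 0. The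
  left side lights the lamps at -r and 1 - r, the right side those at r and r + 1, modulo
  \<open>m\<close>. The lamp at r is lit only on the right.\<close>

lemma lamplighter_G1_relation:
  assumes r: "r > 0" and m: "m = 2 * r + 2"
  obtains x y where "x \<in> carrier (lamplighter m)" "y \<in> carrier (lamplighter m)"
    "fst (G1_relation (lamplighter m) r x y) \<noteq> snd (G1_relation (lamplighter m) r x y)"
proof -
  have m1: "m > 1" using r m by simp
  interpret group "lamplighter m" by (rule group_lamplighter) (use m1 in simp)
  define x y :: "(int \<Rightarrow> bool) \<times> int"
    where "x = (\<lambda>_. False, 1)" and "y = (\<lambda>k. k mod m = 0, 0)"
  have c: "x \<in> carrier (lamplighter m)" "y \<in> carrier (lamplighter m)"
    using m1 by (auto simp: x_def y_def in_carrier_lamplighter)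
  \<comment> \<open>Toggling the same lamp twice restores it, so \<open>y\<close> is an involution
    and the outer powers of \<open>y\<close> disappear.\<close>
  have inv_y: "inv\<^bsub>lamplighter m\<^esub> y = y"
    unfolding y_def using lamplighter_inv[of m 0 "\<lambda>k. k = 0"] m1 by simp
  have pow2: "y [^]\<^bsub>lamplighter m\<^esub> (2::int) = \<one>\<^bsub>lamplighter m\<^esub>"
    using c r_inv[OF c(2)] by (simp add: int_pow_def2 numeral_2_eq_2 inv_y)
  have pow2': "y [^]\<^bsub>lamplighter m\<^esub> (-2::int) = \<one>\<^bsub>lamplighter m\<^esub>"
    using c by (simp add: int_pow_neg pow2)
  have xr: "x [^]\<^bsub>lamplighter m\<^esub> n = (\<lambda>_. False, n mod m)" for n :: int
    unfolding x_def by (rule lamplighter_pow_shift[OF m1])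
  \<comment> \<open>Comparing the two sides at the single position \<open>r\<close>
    suffices.\<close>
  have "fst (fst (G1_relation (lamplighter m) r x y)) r \<longleftrightarrow>
      ((r + r) mod m = 0) \<noteq> ((r + r - 1) mod m = 0)"
    using c by (simp add: G1_relation_def inv_y xr) (simp add: x_def y_def mod_simps)
  moreover have "fst (snd (G1_relation (lamplighter m) r x y)) r \<longleftrightarrow> (0 mod m = 0) \<noteq> ((- 1) mod m = 0)"
    using c by (simp add: G1_relation_def pow2 pow2' inv_y xr)
      (simp add: x_def y_def lamplighter_one mod_simps)
  \<comment> \<open>The choice of \<open>m\<close> puts 2r and 2r - 1 strictly between 0 and
    \<open>m\<close>, so neither residue is 0.\<close>
  moreover have "(r + r) mod m = r + r" "(r + r - 1) mod m = r + r - 1" "(- 1) mod m = m - 1"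
    using r m by (simp_all add: zmod_minus1)
  ultimately have "fst (G1_relation (lamplighter m) r x y) \<noteq> snd (G1_relation (lamplighter m) r x y)"
    using r m by auto
  with c show thesis by (rule that)
qed

section \<open>Transferring relations along an isomorphism\<close>

text \<open>Every assignment of generators in \<open>Q\<close> extends to the first group.
  Precomposing with the isomorphism maps these assignments injectively to assignments that extend to
  the second group; by finiteness all assignments are reached, so every homomorphism
  \<open>f\<close> from the free group respects \<open>S\<close>.\<close>

lemma iso_presented_group_relations:
  fixes X :: "'a set" and Q :: "('b, 'c) monoid_scheme"
  assumes X: "finite X" and Q: "group Q" and fin: "finite (carrier Q)"
    and R: "R \<subseteq> carrier (free_group X) \<times> carrier (free_group X)"
    and S: "S \<subseteq> carrier (free_group X) \<times> carrier (free_group X)"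
    and iso: "presented_group X R \<cong> presented_group X S"
    and rel: "\<And>f u v. f \<in> hom (free_group X) Q \<Longrightarrow> (u, v) \<in> R \<Longrightarrow> f u = f v"
    and f: "f \<in> hom (free_group X) Q" and uv: "(u, v) \<in> S"
  shows "f u = f v"
proof -
  let ?F = "free_group X" and ?E = "PiE X (\<lambda>_. carrier Q)"
  let ?p = "presentation_proj X R" and ?q = "presentation_proj X S"
  \<comment> \<open>The isomorphism is reversed so that precomposition carries homomorphisms out of
    the first group to homomorphisms out of the second.\<close>
  obtain \<phi> where \<phi>: "\<phi> \<in> iso (presented_group X S) (presented_group X R)"
    using group.iso_sym[OF group_presented_group[OF R] iso] by (auto simp: is_iso_def)
  then have \<phi>_hom: "\<phi> \<in> hom (presented_group X S) (presented_group X R)"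
    and \<phi>_surj: "\<phi> ` carrier (presented_group X S) = carrier (presented_group X R)"
    by (auto simp: iso_def bij_betw_def)
  have "\<exists>h. h \<in> hom (presented_group X R) Q \<and> (\<forall>c\<in>X. h (?p (free_gen X c)) = a c)"
    if a: "a \<in> ?E" for a
  proof -
    obtain g where g: "g \<in> hom ?F Q" "\<And>c. c \<in> X \<Longrightarrow> g (free_gen X c) = a c"
      using group.free_group_extend[OF Q, of a X] a by (auto simp: PiE_def)
    obtain h where "h \<in> hom (presented_group X R) Q" "\<And>A. A \<in> carrier ?F \<Longrightarrow> h (?p A) = g A"
      using presented_group_extend[OF R Q g(1)] rel[OF g(1)] by metis
    then show ?thesis using g(2) free_gen_carrier by metis
  qed
  then obtain H where H: "\<And>a. a \<in> ?E \<Longrightarrow> H a \<in> hom (presented_group X R) Q"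
    and H_gen: "\<And>a c. a \<in> ?E \<Longrightarrow> c \<in> X \<Longrightarrow> H a (?p (free_gen X c)) = a c"
    by metis
  \<comment> \<open>\<open>T\<close> records the pulled-back homomorphism by its values on the
    generators; restriction to \<open>X\<close> keeps these tuples extensional.\<close>
  define T where "T a = (\<lambda>c\<in>X. (H a \<circ> \<phi>) (?q (free_gen X c)))" for a
  have H\<phi>: "H a \<circ> \<phi> \<in> hom (presented_group X S) Q" if "a \<in> ?E" for a
    by (rule Group.hom_compose[OF \<phi>_hom H[OF that]])
  have q_gen: "?q (free_gen X c) \<in> carrier (presented_group X S)" if "c \<in> X" for c
    using presentation_proj_surj[OF S] free_gen_carrier[OF that] by blast
  have T_E: "T ` ?E \<subseteq> ?E"
    unfolding T_def using H\<phi> q_gen by (auto simp: hom_def Pi_iff simp del: o_apply)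
  \<comment> \<open>The values on generators determine \<open>H a \<circ> \<phi>\<close>, and
    surjectivity of \<open>\<phi>\<close> then recovers \<open>H a\<close>.\<close>
  have "inj_on T ?E"
  proof (rule inj_onI)
    fix a b assume a: "a \<in> ?E" and b: "b \<in> ?E" and T: "T a = T b"
    have "(H a \<circ> \<phi>) (?q (free_gen X c)) = (H b \<circ> \<phi>) (?q (free_gen X c))" if "c \<in> X" for c
      using fun_cong[OF T, of c] that by (simp add: T_def)
    then have "(H a \<circ> \<phi>) z = (H b \<circ> \<phi>) z" if "z \<in> carrier (presented_group X S)" for z
      using hom_presented_group_eqI[OF S Q H\<phi>[OF a] H\<phi>[OF b]] that by blast
    then have eq: "H a z = H b z" if "z \<in> carrier (presented_group X R)" for z
      using that by (auto simp flip: \<phi>_surj)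
    have "a c = b c" if c: "c \<in> X" for c
      using H_gen[OF a c] H_gen[OF b c] eq[of "?p (free_gen X c)"]
        presentation_proj_surj[OF R] free_gen_carrier[OF c] by simp
    then show "a = b" using a b by (rule_tac PiE_ext) auto
  qed
  then have "T ` ?E = ?E"
    using T_E X fin by (intro endo_inj_surj finite_PiE) auto
  moreover have "(\<lambda>c\<in>X. f (free_gen X c)) \<in> ?E"
    using f free_gen_carrier by (fastforce simp: hom_def Pi_iff)
  ultimately have "(\<lambda>c\<in>X. f (free_gen X c)) \<in> T ` ?E"
    by (simp only:)
  then obtain b where b: "(\<lambda>c\<in>X. f (free_gen X c)) = T b" "b \<in> ?E"
    by (rule imageE)
  \<comment> \<open>Agreement on generators makes \<open>f\<close> factor through the projection to
    the second group, where the relations in \<open>S\<close> hold.\<close>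
  have f_eq: "f A = (H b \<circ> \<phi> \<circ> ?q) A" if "A \<in> carrier ?F" for A
  proof (rule hom_free_group_eqI[OF Q f _ _ that])
    show "H b \<circ> \<phi> \<circ> ?q \<in> hom ?F Q"
      by (rule Group.hom_compose[OF presentation_proj_hom[OF S] H\<phi>[OF b(2)]])
    show "f (free_gen X c) = (H b \<circ> \<phi> \<circ> ?q) (free_gen X c)" if "c \<in> X" for c
      using fun_cong[OF b(1), of c] that by (simp add: T_def)
  qed
  show "f u = f v"
    using uv S f_eq presentation_proj_relation[OF S uv] by auto
qed

section \<open>Naturality of the relations and the conclusion\<close>

text \<open>Both sides are group words, so homomorphisms commute with them; this moves the relation
  between the free group and its images.\<close>

lemma (in group_hom) hom_G1_relation:
  assumes "x \<in> carrier G" "y \<in> carrier G"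
  shows "G1_relation H r (h x) (h y) = map_prod h h (G1_relation G r x y)"
  using assms by (simp add: G1_relation_def hom_int_pow)

lemma (in group_hom) hom_G2_relation:
  assumes "x \<in> carrier G" "y \<in> carrier G"
  shows "G2_relation H (h x) (h y) = map_prod h h (G2_relation G x y)"
  using assms by (simp add: G2_relation_def hom_int_pow)

theorem proposition4p2:
  fixes r :: int
  assumes "r > 0"
  shows "\<not> G2 \<cong> G1 r"
proof
  assume iso: "G2 \<cong> G1 r"
  define m where "m = 2 * r + 2"
  let ?X = "{GenX, GenY}"
  let ?F = "free_group ?X" and ?x = "free_gen ?X GenX" and ?y = "free_gen ?X GenY"
  interpret F: group ?F by (rule group_free_group)
  interpret Q: group "lamplighter m" by (rule group_lamplighter) (use assms in \<open>simp add: m_def\<close>)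
  have gens: "?x \<in> carrier ?F" "?y \<in> carrier ?F" by (simp_all add: free_gen_carrier)
  obtain x y where xy: "x \<in> carrier (lamplighter m)" "y \<in> carrier (lamplighter m)"
      and ne: "fst (G1_relation (lamplighter m) r x y) \<noteq> snd (G1_relation (lamplighter m) r x y)"
    using lamplighter_G1_relation[OF assms m_def] by blast
  \<comment> \<open>\<open>f\<close> sends the free generators to the pair violating the relation of
    \<open>G1 r\<close>.\<close>
  obtain f where f: "f \<in> hom ?F (lamplighter m)"
      "\<And>c. c \<in> ?X \<Longrightarrow> f (free_gen ?X c) = (case c of GenX \<Rightarrow> x | GenY \<Rightarrow> y)"
    using Q.free_group_extend[of "\<lambda>c. case c of GenX \<Rightarrow> x | GenY \<Rightarrow> y" ?X] xy by auto
  \<comment> \<open>Every homomorphism to the wreath product respects the relation of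
    \<open>G2\<close>, so the assumed isomorphism forces \<open>f\<close> to respect that of
    \<open>G1 r\<close>.\<close>
  have eq: "f (fst (G1_relation ?F r ?x ?y)) = f (snd (G1_relation ?F r ?x ?y))"
  proof (rule iso_presented_group_relations[OF _ Q.is_group finite_lamplighter])
    show "presented_group ?X {G2_relation ?F ?x ?y} \<cong> presented_group ?X {G1_relation ?F r ?x ?y}"
      using iso by (simp add: G1_def G2_def)
    show "{G2_relation ?F ?x ?y} \<subseteq> carrier ?F \<times> carrier ?F"
      "{G1_relation ?F r ?x ?y} \<subseteq> carrier ?F \<times> carrier ?F"
      using gens by (simp_all add: G1_relation_def G2_relation_def)
  next
    fix g u v assume g: "g \<in> hom ?F (lamplighter m)" and uv: "(u, v) \<in> {G2_relation ?F ?x ?y}"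
    interpret g: group_hom ?F "lamplighter m" g
      using g by (simp add: group_hom_def group_hom_axioms_def F.is_group Q.is_group)
    have "fst (G2_relation (lamplighter m) (g ?x) (g ?y)) =
        snd (G2_relation (lamplighter m) (g ?x) (g ?y))"
      using gens assms by (intro lamplighter_G2_relation g.hom_closed) (auto simp: m_def)
    moreover have "u = fst (G2_relation ?F ?x ?y)" "v = snd (G2_relation ?F ?x ?y)"
      using uv by (metis fst_conv singletonD, metis snd_conv singletonD)
    ultimately show "g u = g v"
      by (simp add: g.hom_G2_relation[OF gens])
  qed (use f in auto)
  interpret f: group_hom ?F "lamplighter m" f
    using f by (simp add: group_hom_def group_hom_axioms_def F.is_group Q.is_group)
  show False
    using ne eq f.hom_G1_relation[OF gens, of r] f(2) by simp
qed

end
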